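(* Let $p\in\left(0,\frac{1}{2}\right]$, and let $f\colon\left\{ 0,1\right\} ^{n}\to\left\{ 0,1\right\}$ be a monotone Boolean function with $\mu_{p}\left(f\right)$ bounded away from $0$ and $1$ and $\mathrm{I}\left[f\right]\le\frac{K}{p}$. Then there is a set $J$ of $O\left(K\right)$ coordinates such that $\mu_{p}\left(f_{J\to1}\right)\ge\mu_{p}\left(f\right)+e^{-O\left(K\right)}$.
   Context: The cube $\{0,1\}^n$ is equipped with the $p$-biased measure $\mu_p$, under which each coordinate is independently $1$ with probability $p$; for a Boolean function $f$, $\mu_p(f)$ denotes $\Pr_{\boldsymbol{x}\sim\mu_p}[f(\boldsymbol{x})=1]$. A Boolean function $f$ is monotone if $f(x)\le f(y)$ whenever $x_i\le y_i$ for all $i$. For $J\subset[n]$, $f_{J\to1}$ denotes the function on the remaining coordinates obtained from $f$ by fixing all coordinates in $J$ to $1$. The total influence is $\mathrm{I}[f]=\sum_{i=1}^n \mathrm{I}_i[f]$, where $\mathrm{I}_i[f]=\Pr_{\boldsymbol{x}\sim\mu_p}[f(\boldsymbol{x}\oplus e_i)\ne f(\boldsymbol{x})]$ is the $i$th influence (everything depends on the fixed $p$). The implicit constants in $O(K)$ are absolute (depending only on how far $\mu_p(f)$ is from $0$ and $1$). *)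

theory Defs
  imports "HOL-Probability.Probability"
begin

text \<open>
  Points of the cube over a finite coordinate set \<open>S\<close> are functions \<open>nat \<Rightarrow> bool\<close> that are
  \<open>False\<close> outside \<open>S\<close>, so that cubes over different coordinate sets share one type. Boolean
  functions are total on that type; only their values on the cube matter, since
  \<open>biased_pmf S p\<close> is supported there.
\<close>

definition cube :: "nat set \<Rightarrow> (nat \<Rightarrow> bool) set" where
  "cube S = PiE_dflt S False (\<lambda>_. UNIV)"

definition biased_pmf :: "nat set \<Rightarrow> real \<Rightarrow> (nat \<Rightarrow> bool) pmf" where
  "biased_pmf S p = Pi_pmf S False (\<lambda>_. bernoulli_pmf p)"

definition mu :: "nat set \<Rightarrow> real \<Rightarrow> ((nat \<Rightarrow> bool) \<Rightarrow> bool) \<Rightarrow> real" where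
  "mu S p f = measure_pmf.prob (biased_pmf S p) {x. f x}"

definition influence :: "nat set \<Rightarrow> real \<Rightarrow> ((nat \<Rightarrow> bool) \<Rightarrow> bool) \<Rightarrow> nat \<Rightarrow> real" where
  "influence S p f i = measure_pmf.prob (biased_pmf S p) {x. f (x(i := \<not> x i)) \<noteq> f x}"

definition total_influence :: "nat set \<Rightarrow> real \<Rightarrow> ((nat \<Rightarrow> bool) \<Rightarrow> bool) \<Rightarrow> real" where
  "total_influence S p f = (\<Sum>i\<in>S. influence S p f i)"

text \<open>
  If \<open>f\<close> is a Boolean function on \<open>cube S\<close>, then \<open>restrict_to_one J f\<close> is to be read as a
  function on \<open>cube (S - J)\<close>, and its measure is taken over the coordinate set \<open>S - J\<close>.
\<close>

definition restrict_to_one :: "nat set \<Rightarrow> ((nat \<Rightarrow> bool) \<Rightarrow> bool) \<Rightarrow> (nat \<Rightarrow> bool) \<Rightarrow> bool" where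
  "restrict_to_one J f = (\<lambda>y. f (override_on y (\<lambda>_. True) J))"

end

theory Submission
  imports Defs
begin

text \<open>
  Let \<open>\<delta> = e\<^sup>-\<^sup>O\<^sup>(\<^sup>K\<^sup>)\<close> and suppose that no set of \<open>O(K)\<close> coordinates raises the measure by \<open>\<delta>\<close>. As all
  coordinates of \<open>S\<close> vanish with probability at least \<open>2\<^sup>-\<^sup>|\<^sup>S\<^sup>|\<close>, monotonicity forces \<open>f\<^bsub>S\<rightarrow>1\<^esub>\<close> and \<open>f\<^bsub>S\<rightarrow>0\<^esub>\<close> to
  agree outside a set of measure \<open>2\<^sup>|\<^sup>S\<^sup>|\<delta>\<close>, so all small iterated derivatives of the \<open>0/1\<close>-valued
  functions \<open>D\<^sub>i f\<close> have tiny \<open>L\<^sup>2\<close> norm. Hypercontractivity for global functions then bounds the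
  fourth moment of the noisy version of \<open>D\<^sub>i f\<close> by \<open>\<beta> E[D\<^sub>i f]\<close> with \<open>\<beta>\<close> exponentially small in \<open>K\<close>, whence
  the Fourier weight of \<open>D\<^sub>i f\<close>, damped by \<open>8\<^sup>-\<^sup>k\<close> on level \<open>k\<close>, is at most \<open>2\<beta>\<^sup>1\<^sup>/\<^sup>4 E[D\<^sub>i f]\<close>. Summing over \<open>i\<close>, almost none of
  the variance of \<open>f\<close> lies on levels \<open>O(K)\<close>; but \<open>I[f] \<le> K/p\<close> puts half of it there.
\<close>

section \<open>The biased cube, its characters and generalised influences\<close>

locale biased_cube =
  fixes p :: real
  assumes p_pos: "0 < p" and p_half: "p \<le> 1/2"
begin

definition q :: real where "q = p * (1 - p)"

text \<open>A coordinate standardised to mean 0 and variance 1 (\<open>q\<close> is its variance),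
  so that the products \<open>chi T\<close> are the orthonormal p-biased characters.\<close>

definition phi :: "bool \<Rightarrow> real" where
  "phi b = (if b then (1 - p) / sqrt q else - p / sqrt q)"

text \<open>From here on a point of the cube is the set of its coordinates equal to \<open>1\<close>.\<close>

definition expect :: "nat set \<Rightarrow> (nat set \<Rightarrow> real) \<Rightarrow> real" where
  "expect V F = (\<Sum>A\<in>Pow V. p ^ card A * (1 - p) ^ card (V - A) * F A)"

definition chi :: "nat set \<Rightarrow> nat set \<Rightarrow> real" where
  "chi T A = (\<Prod>i\<in>T. phi (i \<in> A))"

definition fourier :: "nat set \<Rightarrow> (nat set \<Rightarrow> real) \<Rightarrow> nat set \<Rightarrow> real" where
  "fourier V f T = expect V (\<lambda>A. f A * chi T A)"

definition expansion :: "nat set \<Rightarrow> (nat set \<Rightarrow> real) \<Rightarrow> nat set \<Rightarrow> real" where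
  "expansion V c A = (\<Sum>T\<in>Pow V. c T * chi T A)"

text \<open>
  With \<open>D\<^sub>S\<close> the iterated difference operator, \<open>weight_above V (fourier V f) S = q\<^sup>|\<^sup>S\<^sup>| E[(D\<^sub>S f)\<^sup>2]\<close>,
  the generalised influence of \<open>S\<close>.
\<close>

definition weight_above :: "nat set \<Rightarrow> (nat set \<Rightarrow> real) \<Rightarrow> nat set \<Rightarrow> real" where
  "weight_above V c S = (\<Sum>T | S \<subseteq> T \<and> T \<subseteq> V. (c T)\<^sup>2)"

text \<open>Not scaled by \<open>sqrt q\<close>, so that on monotone indicators it takes the values
  0 and 1; it is evaluated only at points that lack \<open>i\<close>.\<close>

definition deriv_at :: "nat \<Rightarrow> (nat set \<Rightarrow> real) \<Rightarrow> nat set \<Rightarrow> real" where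
  "deriv_at i f A = f (insert i A) - f A"

section \<open>Expectations as weighted sums over subsets\<close>

lemma q_pos: "0 < q"
  using p_pos p_half by (simp add: q_def)

lemma sum_Pow_insert:
  fixes F :: "nat set \<Rightarrow> real"
  assumes "finite V" "i \<notin> V"
  shows "(\<Sum>A\<in>Pow (insert i V). F A) = (\<Sum>A\<in>Pow V. F A) + (\<Sum>A\<in>Pow V. F (insert i A))"
proof -
  have "inj_on (insert i) (Pow V)"
    using assms by (auto simp: inj_on_def)
  moreover have "Pow V \<inter> insert i ` Pow V = {}"
    using assms by auto
  ultimately show ?thesis
    using assms by (simp add: Pow_insert sum.union_disjoint sum.reindex)
qed

lemma expect_empty [simp]: "expect {} F = F {}"
  by (simp add: expect_def)

lemma expect_insert:
  assumes "finite V" "i \<notin> V"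
  shows "expect (insert i V) F = (1 - p) * expect V F + p * expect V (\<lambda>A. F (insert i A))"
proof -
  have 1: "card (insert i V - A) = Suc (card (V - A))" if "A \<in> Pow V" for A
    using that assms by (subst insert_Diff_if) (auto intro: finite_subset)
  have 2: "card (insert i A) = Suc (card A)" "insert i V - insert i A = V - A" if "A \<in> Pow V" for A
    using that assms by (auto intro: finite_subset card_insert_disjoint)
  show ?thesis
    unfolding expect_def sum_Pow_insert[OF assms] sum_distrib_left
    by (intro arg_cong2[where f = "(+)"] sum.cong refl) (simp_all only: 1 2 power_Suc mult_ac)
qed

lemma expect_cong: "(\<And>A. A \<subseteq> V \<Longrightarrow> F A = G A) \<Longrightarrow> expect V F = expect V G"
  by (auto simp: expect_def intro!: sum.cong)

lemma expect_add: "expect V (\<lambda>A. F A + G A) = expect V F + expect V G"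
  by (simp add: expect_def algebra_simps sum.distrib)

lemma expect_diff: "expect V (\<lambda>A. F A - G A) = expect V F - expect V G"
  by (simp add: expect_def algebra_simps sum_subtractf)

lemma expect_cmult: "expect V (\<lambda>A. c * F A) = c * expect V F"
  by (simp add: expect_def algebra_simps sum_distrib_left)

lemma expect_sum: "expect V (\<lambda>A. \<Sum>t\<in>I. F t A) = (\<Sum>t\<in>I. expect V (F t))"
  unfolding expect_def sum_distrib_left by (rule sum.swap)

lemma expect_mono: "(\<And>A. A \<subseteq> V \<Longrightarrow> F A \<le> G A) \<Longrightarrow> expect V F \<le> expect V G"
  unfolding expect_def using p_pos p_half
  by (intro sum_mono mult_left_mono) auto

lemma expect_const: "finite V \<Longrightarrow> expect V (\<lambda>_. c) = c"
  by (induction V rule: finite_induct) (simp_all add: expect_insert algebra_simps)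

lemma expect_Un:
  assumes "finite J" "finite U" "U \<inter> J = {}"
  shows "expect (U \<union> J) F = expect U (\<lambda>A. expect J (\<lambda>B. F (A \<union> B)))"
  using assms
proof (induction J arbitrary: F rule: finite_induct)
  case (insert i J)
  then show ?case
    by (simp add: expect_insert expect_add expect_cmult)
qed simp

text \<open>All terms but that of the empty point are dropped; \<open>restriction_gap\<close> uses
  this for the event that every coordinate of \<open>J\<close> is 0.\<close>

lemma expect_ge_single:
  assumes "finite J" "\<And>B. B \<subseteq> J \<Longrightarrow> 0 \<le> F B"
  shows "(1 - p) ^ card J * F {} \<le> expect J F"
proof -
  have "p ^ card ({} :: nat set) * (1 - p) ^ card (J - {}) * F {} \<le> expect J F"
    unfolding expect_def
    by (rule member_le_sum[where f = "\<lambda>A. p ^ card A * (1 - p) ^ card (J - A) * F A"])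
      (use assms p_pos p_half in auto)
  then show ?thesis by simp
qed

section \<open>Moments of one coordinate and the two-point inequality\<close>

lemma phi_moments:
  "(1 - p) * phi False + p * phi True = 0"
  "(1 - p) * phi False ^ 2 + p * phi True ^ 2 = 1"
  "(1 - p) * phi False ^ 3 + p * phi True ^ 3 = (1 - 2 * p) / sqrt q"
  "(1 - p) * phi False ^ 4 + p * phi True ^ 4 = (1 - 3 * q) / q"
proof -
  have s: "sqrt q ^ 2 = q" "sqrt q \<noteq> 0" "q \<noteq> 0" using q_pos by auto
  have s3: "sqrt q ^ 3 = q * sqrt q" "sqrt q ^ 4 = q * q"
    using s by (simp_all add: power3_eq_cube power4_eq_xxxx power2_eq_square)
  show "(1 - p) * phi False + p * phi True = 0"
    by (simp add: phi_def)
  have "(1 - p) * phi False ^ 2 + p * phi True ^ 2 = ((1 - p) * p^2 + p * (1 - p)^2) / q"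
    using s by (simp add: phi_def power_divide add_divide_distrib)
  also have "(1 - p) * p^2 + p * (1 - p)^2 = q"
    unfolding q_def by algebra
  finally show "(1 - p) * phi False ^ 2 + p * phi True ^ 2 = 1" using s by simp
  have "(1 - p) * phi False ^ 3 + p * phi True ^ 3 = (p * (1 - p)^3 - (1 - p) * p^3) / (q * sqrt q)"
    using s3 by (simp add: phi_def power_divide) (simp add: diff_divide_distrib)
  also have "p * (1 - p)^3 - (1 - p) * p^3 = q * (1 - 2 * p)"
    unfolding q_def by algebra
  finally show "(1 - p) * phi False ^ 3 + p * phi True ^ 3 = (1 - 2 * p) / sqrt q" using s by simp
  have "(1 - p) * phi False ^ 4 + p * phi True ^ 4 = ((1 - p) * p^4 + p * (1 - p)^4) / (q * q)"
    using s s3 by (simp add: phi_def power_divide add_divide_distrib)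
  also have "(1 - p) * p^4 + p * (1 - p)^4 = q * (1 - 3 * q)"
    unfolding q_def by algebra
  finally show "(1 - p) * phi False ^ 4 + p * phi True ^ 4 = (1 - 3 * q) / q" using s by simp
qed

text \<open>The one-coordinate case of hypercontractivity: \<open>b\<close> and \<open>d\<close> are
  the parts of two functions that multiply \<open>phi\<close>, damped by the noise rate 1/2.
  Expanding in powers of \<open>phi\<close> leaves its moments; mixed terms go by AM-GM, and only
  \<open>b\<^sup>2 * d\<^sup>2\<close> has to absorb quantities of order
  \<open>1 / q\<close>.\<close>

lemma two_point_inequality:
  "(1 - p) * ((a + phi False * (b / 2))\<^sup>2 * (c + phi False * (d / 2))\<^sup>2)
     + p * ((a + phi True * (b / 2))\<^sup>2 * (c + phi True * (d / 2))\<^sup>2)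
   \<le> a\<^sup>2 * c\<^sup>2 + a\<^sup>2 * d\<^sup>2 + b\<^sup>2 * c\<^sup>2 + b\<^sup>2 * d\<^sup>2 / q"
proof -
  define g where "g = (1 - 2 * p) / sqrt q"
  have ex: "(a + x * (b / 2))\<^sup>2 * (c + x * (d / 2))\<^sup>2
      = a\<^sup>2 * c\<^sup>2 + x * (a\<^sup>2 * c * d + a * b * c\<^sup>2)
        + x^2 * (a\<^sup>2 * d\<^sup>2 / 4 + a * b * c * d + b\<^sup>2 * c\<^sup>2 / 4)
        + x^3 * (a * b * d\<^sup>2 / 4 + b\<^sup>2 * c * d / 4) + x^4 * (b\<^sup>2 * d\<^sup>2 / 16)" for x
    by (simp add: power2_eq_square power3_eq_cube power4_eq_xxxx algebra_simps)
  have comb: "(1 - p) * (c0 + x * c1 + x^2 * c2 + x^3 * c3 + x^4 * c4)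
      + p * (c0 + y * c1 + y^2 * c2 + y^3 * c3 + y^4 * c4)
      = c0 + ((1 - p) * x + p * y) * c1 + ((1 - p) * x^2 + p * y^2) * c2
        + ((1 - p) * x^3 + p * y^3) * c3 + ((1 - p) * x^4 + p * y^4) * c4"
    for x y c0 c1 c2 c3 c4 :: real
    by (simp add: algebra_simps)
  \<comment> \<open>\<open>g\<close> is the third moment of \<open>phi\<close>; its square, produced
    by AM-GM below, thus fits into the \<open>1 / q\<close> term.\<close>
  have g2: "g\<^sup>2 \<le> 1 / q"
  proof -
    have "g\<^sup>2 = (1 - 2 * p)\<^sup>2 / q"
      unfolding g_def using q_pos by (simp add: power_divide)
    moreover have "(1 - 2 * p)\<^sup>2 \<le> 1"
      using p_pos p_half by (intro power_le_one) auto
    ultimately show ?thesis using q_pos by (simp add: divide_right_mono)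
  qed
  have b1: "a * b * c * d \<le> (a\<^sup>2 * d\<^sup>2 + b\<^sup>2 * c\<^sup>2) / 2"
    using zero_le_power2[of "a * d - b * c"] by (simp add: power2_eq_square algebra_simps)
  have b2: "g * (a * b * d\<^sup>2) \<le> (a\<^sup>2 * d\<^sup>2 + b\<^sup>2 * d\<^sup>2 * g\<^sup>2) / 2"
    using zero_le_power2[of "a * d - b * d * g"] by (simp add: power2_eq_square algebra_simps)
  have b3: "g * (b\<^sup>2 * c * d) \<le> (b\<^sup>2 * c\<^sup>2 + b\<^sup>2 * d\<^sup>2 * g\<^sup>2) / 2"
    using zero_le_power2[of "b * c - b * d * g"] by (simp add: power2_eq_square algebra_simps)
  have b4: "b\<^sup>2 * d\<^sup>2 * g\<^sup>2 \<le> b\<^sup>2 * d\<^sup>2 / q"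
    using mult_left_mono[OF g2, of "b\<^sup>2 * d\<^sup>2"] by simp
  have "(1 - 3 * q) / q \<le> 1 / q" using q_pos by (simp add: divide_right_mono)
  then have b5: "(1 - 3 * q) / q * (b\<^sup>2 * d\<^sup>2) \<le> b\<^sup>2 * d\<^sup>2 / q"
    using mult_right_mono[of "(1 - 3 * q) / q" "1 / q" "b\<^sup>2 * d\<^sup>2"] by simp
  have nn: "0 \<le> a\<^sup>2 * d\<^sup>2" "0 \<le> b\<^sup>2 * c\<^sup>2" "0 \<le> b\<^sup>2 * d\<^sup>2 / q"
    using q_pos by auto
  have "(1 - p) * ((a + phi False * (b / 2))\<^sup>2 * (c + phi False * (d / 2))\<^sup>2)
     + p * ((a + phi True * (b / 2))\<^sup>2 * (c + phi True * (d / 2))\<^sup>2)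
     = a\<^sup>2 * c\<^sup>2 + (a\<^sup>2 * d\<^sup>2 / 4 + a * b * c * d + b\<^sup>2 * c\<^sup>2 / 4)
       + g * (a * b * d\<^sup>2 / 4 + b\<^sup>2 * c * d / 4) + (1 - 3 * q) / q * (b\<^sup>2 * d\<^sup>2 / 16)"
    unfolding ex comb phi_moments g_def by simp
  also have "\<dots> = a\<^sup>2 * c\<^sup>2 + (a\<^sup>2 * d\<^sup>2 / 4 + a * b * c * d + b\<^sup>2 * c\<^sup>2 / 4)
       + g * (a * b * d\<^sup>2) / 4 + g * (b\<^sup>2 * c * d) / 4 + ((1 - 3 * q) / q * (b\<^sup>2 * d\<^sup>2)) / 16"
    by (simp add: algebra_simps)
  \<comment> \<open>The coefficients sum to 7/8 on \<open>a\<^sup>2 * d\<^sup>2\<close> and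
    \<open>b\<^sup>2 * c\<^sup>2\<close> and to 5/16 on \<open>b\<^sup>2 * d\<^sup>2 / q\<close>, so
    the noise rate 1/2 suffices.\<close>
  also have "\<dots> \<le> a\<^sup>2 * c\<^sup>2 + a\<^sup>2 * d\<^sup>2 + b\<^sup>2 * c\<^sup>2 + b\<^sup>2 * d\<^sup>2 / q"
    using b1 b2 b3 b4 b5 nn by argo
  finally show ?thesis .
qed

section \<open>Characters, expansions and weights when a coordinate is added\<close>

lemma chi_insert_point: "T \<subseteq> V \<Longrightarrow> i \<notin> V \<Longrightarrow> chi T (insert i A) = chi T A"
  unfolding chi_def by (intro prod.cong refl arg_cong[where f = phi]) auto

lemma chi_insert: "finite T \<Longrightarrow> i \<notin> T \<Longrightarrow> chi (insert i T) A = phi (i \<in> A) * chi T A"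
  by (simp add: chi_def)

lemma expansion_insert:
  assumes "finite V" "i \<notin> V"
  shows "expansion (insert i V) c A
    = expansion V c A + phi (i \<in> A) * expansion V (\<lambda>T. c (insert i T)) A"
proof -
  have "chi (insert i T) A = phi (i \<in> A) * chi T A" if "T \<in> Pow V" for T
    using that assms by (intro chi_insert) (auto intro: finite_subset)
  then show ?thesis
    by (simp add: expansion_def sum_Pow_insert[OF assms] sum_distrib_left mult_ac)
qed

lemma expansion_insert_point: "i \<notin> V \<Longrightarrow> expansion V c (insert i A) = expansion V c A"
  unfolding expansion_def by (intro sum.cong refl) (auto simp: chi_insert_point)

lemma weight_above_Pow:
  "finite V \<Longrightarrow> weight_above V c S = (\<Sum>T\<in>Pow V. if S \<subseteq> T then (c T)\<^sup>2 else 0)"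
  unfolding weight_above_def by (intro sum.mono_neutral_cong_left) auto

lemma weight_above_nonneg: "0 \<le> weight_above V c S"
  by (simp add: weight_above_def sum_nonneg)

text \<open>The sets above \<open>S\<close> split by whether they contain \<open>i\<close>; once
  \<open>S\<close> contains \<open>i\<close>, only the second kind is left. The inductions on the
  dimension rest on this recursion.\<close>

lemma weight_above_insert:
  assumes "finite V" "i \<notin> V" "S \<subseteq> V"
  shows "weight_above (insert i V) c S = weight_above V c S + weight_above V (\<lambda>T. c (insert i T)) S"
    and "weight_above (insert i V) c (insert i S) = weight_above V (\<lambda>T. c (insert i T)) S"
proof -
  have 1: "S \<subseteq> insert i T \<longleftrightarrow> S \<subseteq> T" for T using assms by auto
  have 2: "(\<Sum>T\<in>Pow V. if insert i S \<subseteq> T then (c T)\<^sup>2 else 0) = 0"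
    using assms by (intro sum.neutral) auto
  have 3: "insert i S \<subseteq> insert i T \<longleftrightarrow> S \<subseteq> T" for T using assms by auto
  show "weight_above (insert i V) c S = weight_above V c S + weight_above V (\<lambda>T. c (insert i T)) S"
    using assms by (simp add: weight_above_Pow sum_Pow_insert 1)
  show "weight_above (insert i V) c (insert i S) = weight_above V (\<lambda>T. c (insert i T)) S"
    by (simp only: weight_above_Pow[OF finite.insertI[OF assms(1)]] weight_above_Pow[OF assms(1)]
        sum_Pow_insert[OF assms(1,2)] 2 3 add_0_left)
qed

section \<open>Hypercontractivity\<close>

text \<open>
  For \<open>c = d\<close> this bounds the fourth norm of the noisy function. Induction on the dimension needs two
  functions: Cauchy-Schwarz on the mixed terms of the version with one function loses too much.
\<close>

lemma hypercontractive:
  assumes "finite V"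
  shows "expect V (\<lambda>A. (expansion V (\<lambda>T. (1/2) ^ card T * c T) A)\<^sup>2
                     * (expansion V (\<lambda>T. (1/2) ^ card T * d T) A)\<^sup>2)
    \<le> (\<Sum>S\<in>Pow V. weight_above V c S * weight_above V d S / q ^ card S)"
  using assms
proof (induction V arbitrary: c d rule: finite_induct)
  case empty
  have "{T. T = ({}::nat set)} = {{}}" by auto
  then show ?case
    by (simp add: expansion_def weight_above_def chi_def)
next
  case (insert i V)
  let ?N = "\<lambda>c A. expansion V (\<lambda>T. (1/2) ^ card T * c T) A"
  let ?c = "\<lambda>T. c (insert i T)" and ?d = "\<lambda>T. d (insert i T)"
  let ?w = "weight_above V"
  let ?B = "\<lambda>c d. \<Sum>S\<in>Pow V. ?w c S * ?w d S / q ^ card S"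
  \<comment> \<open>Sets containing \<open>i\<close> lie one level higher, so noise costs this slice
    a further 1/2: the damping of \<open>b\<close> and \<open>d\<close> in
    \<open>two_point_inequality\<close>.\<close>
  have half: "expansion V (\<lambda>T. (1/2) ^ card (insert i T) * c (insert i T)) A = ?N (\<lambda>T. c (insert i T)) A / 2"
    for c A
  proof -
    have "card (insert i T) = Suc (card T)" if "T \<in> Pow V" for T
      using that insert.hyps by (auto intro: finite_subset card_insert_disjoint)
    then show ?thesis
      by (simp add: expansion_def sum_divide_distrib)
  qed
  have exp_eq: "expansion (insert i V) (\<lambda>T. (1/2) ^ card T * c T) A
      = ?N c A + phi (i \<in> A) * (?N (\<lambda>T. c (insert i T)) A / 2)" for c A
    using insert.hyps by (simp add: expansion_insert half)
  let ?F = "\<lambda>x A. (?N c A + phi x * (?N ?c A / 2))\<^sup>2 * (?N d A + phi x * (?N ?d A / 2))\<^sup>2"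
  have "expect (insert i V) (\<lambda>A. (expansion (insert i V) (\<lambda>T. (1/2) ^ card T * c T) A)\<^sup>2
                     * (expansion (insert i V) (\<lambda>T. (1/2) ^ card T * d T) A)\<^sup>2)
     = (1 - p) * expect V (?F False) + p * expect V (?F True)"
  proof -
    have "expect V (\<lambda>A. ?F (i \<in> A) A) = expect V (?F False)"
    proof (rule expect_cong)
      fix A assume "A \<subseteq> V"
      then have "(i \<in> A) = False" using insert.hyps by auto
      then show "?F (i \<in> A) A = ?F False A" by (simp only:)
    qed
    then show ?thesis
      unfolding exp_eq using insert.hyps
      by (simp add: expect_insert expansion_insert_point)
  qed
  also have "\<dots> = expect V (\<lambda>A. (1 - p) * ?F False A + p * ?F True A)"
    by (simp only: expect_add expect_cmult)
  also have "\<dots> \<le> expect V (\<lambda>A. (?N c A)\<^sup>2 * (?N d A)\<^sup>2 + (?N c A)\<^sup>2 * (?N ?d A)\<^sup>2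
      + (?N ?c A)\<^sup>2 * (?N d A)\<^sup>2 + (1 / q) * ((?N ?c A)\<^sup>2 * (?N ?d A)\<^sup>2))"
    using two_point_inequality by (intro expect_mono) simp
  also have "\<dots> = expect V (\<lambda>A. (?N c A)\<^sup>2 * (?N d A)\<^sup>2) + expect V (\<lambda>A. (?N c A)\<^sup>2 * (?N ?d A)\<^sup>2)
      + expect V (\<lambda>A. (?N ?c A)\<^sup>2 * (?N d A)\<^sup>2) + (1 / q) * expect V (\<lambda>A. (?N ?c A)\<^sup>2 * (?N ?d A)\<^sup>2)"
    by (simp only: expect_add expect_cmult)
  \<comment> \<open>The induction hypothesis is applied to the four pairs formed from
    \<open>c\<close>, \<open>d\<close> and their slices \<open>?c\<close>,
    \<open>?d\<close>.\<close>
  also have "\<dots> \<le> ?B c d + ?B c ?d + ?B ?c d + (1 / q) * ?B ?c ?d"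
    using q_pos by (intro add_mono mult_left_mono insert.IH) auto
  also have "\<dots> = (\<Sum>S\<in>Pow V. (?w c S * ?w d S + ?w c S * ?w ?d S + ?w ?c S * ?w d S) / q ^ card S
      + ?w ?c S * ?w ?d S / q ^ Suc (card S))"
    by (simp add: sum.distrib sum_distrib_left add_divide_distrib)
  \<comment> \<open>Adding the nonnegative product \<open>?w ?c S * ?w ?d S\<close> completes the
    terms of sets without \<open>i\<close>; the last summand is already the term of
    \<open>insert i S\<close>.\<close>
  also have "\<dots> \<le> (\<Sum>S\<in>Pow V. (?w c S + ?w ?c S) * (?w d S + ?w ?d S) / q ^ card S
      + ?w ?c S * ?w ?d S / q ^ Suc (card S))"
    using q_pos weight_above_nonneg
    by (intro sum_mono add_right_mono divide_right_mono) (auto simp: algebra_simps)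
  also have "\<dots> = (\<Sum>S\<in>Pow (insert i V). weight_above (insert i V) c S * weight_above (insert i V) d S / q ^ card S)"
  proof -
    have "card (insert i S) = Suc (card S)" if "S \<in> Pow V" for S
      using that insert.hyps by (auto intro: finite_subset card_insert_disjoint)
    then show ?thesis
      using insert.hyps by (simp add: sum_Pow_insert sum.distrib weight_above_insert)
  qed
  finally show ?case .
qed

section \<open>Fourier coefficients, derivatives and Parseval\<close>

lemma fourier_insert:
  assumes "finite V" "i \<notin> V" "T \<subseteq> V"
  shows "fourier (insert i V) f T = fourier V (\<lambda>A. (1 - p) * f A + p * f (insert i A)) T"
    and "fourier (insert i V) f (insert i T) = sqrt q * fourier V (deriv_at i f) T"
proof -
  have c: "chi T (insert i A) = chi T A" for A using assms by (simp add: chi_insert_point)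
  have "((1 - p) * f A + p * f (insert i A)) * chi T A
      = (1 - p) * (f A * chi T A) + p * (f (insert i A) * chi T A)" for A
    by (simp add: algebra_simps)
  then show "fourier (insert i V) f T = fourier V (\<lambda>A. (1 - p) * f A + p * f (insert i A)) T"
    by (simp only: fourier_def expect_insert[OF assms(1,2)] c expect_add expect_cmult)
  have fT: "finite T" "i \<notin> T" using assms by (auto intro: finite_subset)
  have s: "sqrt q \<noteq> 0" "sqrt q * sqrt q = p * (1 - p)" using q_pos by (auto simp: q_def)
  \<comment> \<open>Integrating the coordinate \<open>i\<close> against \<open>phi\<close> thus
    yields \<open>sqrt q\<close> times a difference of two values of \<open>f\<close>.\<close>
  have phi: "(1 - p) * phi False = - sqrt q" "p * phi True = sqrt q"
    using s by (simp_all add: phi_def field_simps)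
  have e: "expect V (\<lambda>A. f A * (phi (i \<in> A) * chi T A)) = expect V (\<lambda>A. phi False * (f A * chi T A))"
  proof (rule expect_cong)
    fix A assume "A \<subseteq> V"
    then have "i \<notin> A" using assms by auto
    then show "f A * (phi (i \<in> A) * chi T A) = phi False * (f A * chi T A)" by simp
  qed
  have e': "expect V (\<lambda>A. f (insert i A) * (phi True * chi T A))
      = expect V (\<lambda>A. phi True * (f (insert i A) * chi T A))"
    by (simp add: mult_ac)
  have "fourier (insert i V) f (insert i T)
    = ((1 - p) * phi False) * expect V (\<lambda>A. f A * chi T A)
      + (p * phi True) * expect V (\<lambda>A. f (insert i A) * chi T A)"
    using assms fT
    by (simp add: fourier_def expect_insert chi_insert c e e' expect_cmult)
  also have "\<dots> = sqrt q * fourier V (deriv_at i f) T"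
    unfolding phi by (simp add: fourier_def deriv_at_def left_diff_distrib expect_diff right_diff_distrib)
  finally show "fourier (insert i V) f (insert i T) = sqrt q * fourier V (deriv_at i f) T" .
qed

lemma fourier_inversion:
  assumes "finite V" "A \<subseteq> V"
  shows "expansion V (fourier V f) A = f A"
  using assms
proof (induction V arbitrary: f A rule: finite_induct)
  case empty
  then show ?case by (simp add: expansion_def fourier_def chi_def)
next
  case (insert i V)
  define B where "B = A - {i}"
  have B: "B \<subseteq> V" using insert.prems by (auto simp: B_def)
  have AB: "expansion V c A = expansion V c B" for c
    using insert.hyps expansion_insert_point[of i V c B]
    by (cases "i \<in> A") (auto simp: B_def insert_absorb)
  have e1: "expansion V (fourier (insert i V) f) B = (1 - p) * f B + p * f (insert i B)"
  proof -
    have "expansion V (fourier (insert i V) f) B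
        = expansion V (fourier V (\<lambda>A. (1 - p) * f A + p * f (insert i A))) B"
      unfolding expansion_def
      by (intro sum.cong refl) (use insert.hyps in \<open>auto simp: fourier_insert\<close>)
    then show ?thesis using insert.IH[OF B] by simp
  qed
  have e2: "expansion V (\<lambda>T. fourier (insert i V) f (insert i T)) B = sqrt q * deriv_at i f B"
  proof -
    have "expansion V (\<lambda>T. fourier (insert i V) f (insert i T)) B
        = sqrt q * expansion V (fourier V (deriv_at i f)) B"
      unfolding expansion_def sum_distrib_left
      by (intro sum.cong refl) (use insert.hyps in \<open>auto simp: fourier_insert\<close>)
    then show ?thesis using insert.IH[OF B] by simp
  qed
  \<comment> \<open>This factor is the coordinate minus \<open>p\<close>: the two slices give the
    average of \<open>f\<close> over the coordinate \<open>i\<close> plus this deviation times the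
    derivative.\<close>
  have "phi (i \<in> A) * sqrt q = (if i \<in> A then 1 - p else - p)"
    using q_pos by (simp add: phi_def)
  then have "expansion (insert i V) (fourier (insert i V) f) A
      = (1 - p) * f B + p * f (insert i B) + (if i \<in> A then 1 - p else - p) * deriv_at i f B"
    using insert.hyps by (simp add: expansion_insert AB e1 e2 mult.assoc[symmetric])
  also have "\<dots> = f A"
    by (cases "i \<in> A") (auto simp: B_def deriv_at_def insert_absorb algebra_simps)
  finally show ?case .
qed

lemma expect_mult_expansion:
  "expect V (\<lambda>A. h A * expansion V c A) = (\<Sum>T\<in>Pow V. c T * fourier V h T)"
proof -
  have "(\<lambda>A. h A * expansion V c A) = (\<lambda>A. \<Sum>T\<in>Pow V. c T * (h A * chi T A))"
    by (auto simp: expansion_def sum_distrib_left mult_ac)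
  then show ?thesis
    by (simp add: expect_sum expect_cmult fourier_def)
qed

text \<open>Inversion replaces one factor of the square by its expansion, and
  \<open>expect_mult_expansion\<close> pairs it with the other.\<close>

lemma parseval:
  assumes "finite V"
  shows "expect V (\<lambda>A. (f A)\<^sup>2) = (\<Sum>T\<in>Pow V. (fourier V f T)\<^sup>2)"
proof -
  have "expect V (\<lambda>A. (f A)\<^sup>2) = expect V (\<lambda>A. f A * expansion V (fourier V f) A)"
    using assms by (intro expect_cong) (simp add: fourier_inversion power2_eq_square)
  then show ?thesis by (simp add: expect_mult_expansion power2_eq_square)
qed

text \<open>By \<open>fourier_insert\<close>, each coordinate of \<open>S\<close> costs a factor
  \<open>q\<close> and replaces \<open>g\<close> by a derivative, which at most doubles the sup
  norm; squared, this gives \<open>(4 * q) ^ card S\<close>. The iterated derivative vanishes above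
  every point of \<open>V - S\<close> on whose whole fibre \<open>g\<close> vanishes;
  \<open>N\<close> covers the remaining points.\<close>

lemma weight_above_bound:
  assumes "finite V" "S \<subseteq> V"
    and "\<And>A. A \<subseteq> V \<Longrightarrow> \<bar>g A\<bar> \<le> M"
    and "\<And>A T. A \<subseteq> V - S \<Longrightarrow> T \<subseteq> S \<Longrightarrow> \<not> N A \<Longrightarrow> g (A \<union> T) = 0"
  shows "weight_above V (fourier V g) S \<le> (4 * q) ^ card S * M\<^sup>2 * expect (V - S) (\<lambda>A. of_bool (N A))"
proof -
  have "finite S" using assms by (auto intro: finite_subset)
  then show ?thesis using assms
  proof (induction S arbitrary: V g M rule: finite_induct)
    case empty
    have "weight_above V (fourier V g) {} = expect V (\<lambda>A. (g A)\<^sup>2)"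
      using empty.prems by (simp add: parseval weight_above_Pow)
    also have "\<dots> \<le> expect V (\<lambda>A. M\<^sup>2 * of_bool (N A))"
    proof (rule expect_mono)
      fix A assume A: "A \<subseteq> V"
      show "(g A)\<^sup>2 \<le> M\<^sup>2 * of_bool (N A)"
        using empty.prems(3)[OF A] empty.prems(4)[of A "{}"] A
        by (cases "N A") (auto simp: abs_le_square_iff[symmetric])
    qed
    finally show ?case by (simp add: expect_cmult)
  next
    case (insert i S)
    define U where "U = V - {i}"
    have V: "V = insert i U" "i \<notin> U" "finite U" "S \<subseteq> U"
      using insert.prems insert.hyps by (auto simp: U_def)
    have D: "V - insert i S = U - S" by (auto simp: U_def)
    have "weight_above V (fourier V g) (insert i S) = weight_above U (\<lambda>T. fourier V g (insert i T)) S"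
      unfolding V(1) using V by (simp add: weight_above_insert)
    also have "\<dots> = q * weight_above U (fourier U (deriv_at i g)) S"
      unfolding weight_above_def sum_distrib_left V(1)
      using V q_pos by (intro sum.cong refl) (auto simp: fourier_insert power_mult_distrib)
    also have "\<dots> \<le> q * ((4 * q) ^ card S * (2 * M)\<^sup>2 * expect (U - S) (\<lambda>A. of_bool (N A)))"
    proof (intro mult_left_mono insert.IH)
      fix A assume "A \<subseteq> U"
      then have "\<bar>g (insert i A)\<bar> \<le> M" "\<bar>g A\<bar> \<le> M"
        using insert.prems(3)[of A] insert.prems(3)[of "insert i A"] V by blast+
      then show "\<bar>deriv_at i g A\<bar> \<le> 2 * M" by (auto simp: deriv_at_def)
    next
      fix A T assume A: "A \<subseteq> U - S" "T \<subseteq> S" "\<not> N A"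
      then have "g (A \<union> T) = 0" "g (A \<union> insert i T) = 0"
        using insert.prems(4)[of A T] insert.prems(4)[of A "insert i T"] unfolding D by auto
      then show "deriv_at i g (A \<union> T) = 0" by (simp add: deriv_at_def)
    qed (use V q_pos in auto)
    also have "\<dots> = (4 * q) ^ card (insert i S) * M\<^sup>2 * expect (V - insert i S) (\<lambda>A. of_bool (N A))"
      using insert.hyps by (simp add: D power_mult_distrib)
    finally show ?case .
  qed
qed


section \<open>Noise stability of 0/1-valued functions with small generalised influences\<close>

lemma sum_weight_above:
  assumes "finite V"
  shows "(\<Sum>S\<in>Pow V. weight_above V c S) = (\<Sum>T\<in>Pow V. 2 ^ card T * (c T)\<^sup>2)"
proof -
  have "(\<Sum>S\<in>Pow V. weight_above V c S) = (\<Sum>T\<in>Pow V. \<Sum>S\<in>Pow V. if S \<subseteq> T then (c T)\<^sup>2 else 0)"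
    unfolding weight_above_Pow[OF assms] by (rule sum.swap)
  also have "\<dots> = (\<Sum>T\<in>Pow V. 2 ^ card T * (c T)\<^sup>2)"
  proof (rule sum.cong[OF refl])
    fix T assume T: "T \<in> Pow V"
    then have "finite T" using assms by (auto intro: finite_subset)
    have "(\<Sum>S\<in>Pow V. if S \<subseteq> T then (c T)\<^sup>2 else 0) = (\<Sum>S\<in>Pow T. (c T)\<^sup>2)"
      using T assms by (intro sum.mono_neutral_cong_right) auto
    then show "(\<Sum>S\<in>Pow V. if S \<subseteq> T then (c T)\<^sup>2 else 0) = 2 ^ card T * (c T)\<^sup>2"
      using \<open>finite T\<close> by (simp add: card_Pow)
  qed
  finally show ?thesis .
qed

text \<open>
  The noise rate \<open>1/8\<close> splits as \<open>1/2\<close>, spent on hypercontractivity, times \<open>1/4\<close>, which compensates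
  for the growth \<open>16\<^sup>|\<^sup>S\<^sup>|\<close> in the hypothesis. Since \<open>h\<close> is \<open>0/1\<close>-valued, \<open>h G \<le> s h + G\<^sup>4 / s\<^sup>3\<close> replaces
  Hoelder's inequality with exponents \<open>4/3\<close> and \<open>4\<close>.
\<close>

lemma noise_stability_bound:
  assumes fin: "finite V" and s: "0 < s"
    and h01: "\<And>A. A \<subseteq> V \<Longrightarrow> h A = 0 \<or> h A = 1"
    and W: "\<And>S. S \<subseteq> V \<Longrightarrow> weight_above V (fourier V h) S \<le> s ^ 4 * (16 * q) ^ card S"
  shows "(\<Sum>T\<in>Pow V. (1/8) ^ card T * (fourier V h T)\<^sup>2) \<le> 2 * s * expect V h"
proof -
  define c where "c T = (1/4) ^ card T * fourier V h T" for T
  \<comment> \<open>\<open>G\<close> is \<open>h\<close> under the full noise rate 1/8, so the left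
    side of the claim is the expectation of \<open>h * G\<close>.\<close>
  define G where "G = expansion V (\<lambda>T. (1/2) ^ card T * c T)"
  have w: "weight_above V c S \<le> s ^ 4 * q ^ card S" if S: "S \<subseteq> V" for S
  proof -
    have "weight_above V c S \<le> (1/16) ^ card S * weight_above V (fourier V h) S"
      unfolding weight_above_def sum_distrib_left
    proof (rule sum_mono)
      fix T assume T: "T \<in> {T. S \<subseteq> T \<and> T \<subseteq> V}"
      then have "card S \<le> card T"
        using fin by (auto intro!: card_mono intro: finite_subset)
      then have "(1/16::real) ^ card T \<le> (1/16) ^ card S"
        by (intro power_decreasing) auto
      moreover have "(c T)\<^sup>2 = (1/16) ^ card T * (fourier V h T)\<^sup>2"
        by (simp add: c_def power_mult_distrib power2_eq_square power_mult_distrib[symmetric])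
      ultimately show "(c T)\<^sup>2 \<le> (1/16) ^ card S * (fourier V h T)\<^sup>2"
        by (simp add: mult_right_mono)
    qed
    also have "\<dots> \<le> (1/16) ^ card S * (s ^ 4 * (16 * q) ^ card S)"
      by (intro mult_left_mono W S) auto
    also have "\<dots> = s ^ 4 * q ^ card S"
      by (simp add: power_mult_distrib power_one_over)
    finally show ?thesis .
  qed
  have "(\<Sum>T\<in>Pow V. (1/8) ^ card T * (fourier V h T)\<^sup>2) = expect V (\<lambda>A. h A * G A)"
    unfolding G_def expect_mult_expansion
    by (intro sum.cong refl)
      (simp add: c_def power2_eq_square power_mult_distrib[symmetric] mult.assoc[symmetric])
  also have "\<dots> \<le> expect V (\<lambda>A. s * h A + 1 / s ^ 3 * ((G A)\<^sup>2 * (G A)\<^sup>2))"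
  proof (rule expect_mono)
    fix A assume "A \<subseteq> V"
    then consider "h A = 0" | "h A = 1" using h01 by blast
    then show "h A * G A \<le> s * h A + 1 / s ^ 3 * ((G A)\<^sup>2 * (G A)\<^sup>2)"
    proof cases
      case 1
      then show ?thesis using s by simp
    next
      case 2
      have nn: "0 \<le> 1 / s ^ 3 * ((G A)\<^sup>2 * (G A)\<^sup>2)" using s by simp
      show ?thesis
      proof (cases "G A \<le> s")
        case True
        then show ?thesis using 2 nn by simp
      next
        case False
        then have "G A * s ^ 3 \<le> G A * G A ^ 3"
          using s by (intro mult_left_mono power_mono) auto
        also have "\<dots> = (G A)\<^sup>2 * (G A)\<^sup>2"
          by (simp add: power2_eq_square power3_eq_cube)
        finally have "G A \<le> 1 / s ^ 3 * ((G A)\<^sup>2 * (G A)\<^sup>2)"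
          using s by (simp add: field_simps)
        then show ?thesis using 2 s by simp
      qed
    qed
  qed
  also have "\<dots> = s * expect V h + 1 / s ^ 3 * expect V (\<lambda>A. (G A)\<^sup>2 * (G A)\<^sup>2)"
    by (simp only: expect_add expect_cmult)
  also have "\<dots> \<le> s * expect V h + 1 / s ^ 3 * (s ^ 4 * expect V h)"
  proof -
    have "expect V (\<lambda>A. (G A)\<^sup>2 * (G A)\<^sup>2)
        \<le> (\<Sum>S\<in>Pow V. weight_above V c S * weight_above V c S / q ^ card S)"
      unfolding G_def by (rule hypercontractive[OF fin])
    \<comment> \<open>One of the two weights is bounded uniformly, cancelling
      \<open>q ^ card S\<close>; the other is kept and summed exactly.\<close>
    also have "\<dots> \<le> (\<Sum>S\<in>Pow V. s ^ 4 * weight_above V c S)"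
    proof (rule sum_mono)
      fix S assume "S \<in> Pow V"
      then have "weight_above V c S * weight_above V c S \<le> (s ^ 4 * q ^ card S) * weight_above V c S"
        by (intro mult_right_mono w weight_above_nonneg) auto
      then show "weight_above V c S * weight_above V c S / q ^ card S \<le> s ^ 4 * weight_above V c S"
        using q_pos by (simp add: field_simps)
    qed
    also have "\<dots> = s ^ 4 * (\<Sum>T\<in>Pow V. 2 ^ card T * (c T)\<^sup>2)"
      by (simp add: sum_distrib_left[symmetric] sum_weight_above fin)
    also have "\<dots> \<le> s ^ 4 * (\<Sum>T\<in>Pow V. (fourier V h T)\<^sup>2)"
    proof (intro mult_left_mono sum_mono)
      fix T
      have "2 ^ card T * (c T)\<^sup>2 = (1/8) ^ card T * (fourier V h T)\<^sup>2"
        by (simp add: c_def power_mult_distrib power2_eq_square power_mult_distrib[symmetric]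
            mult.assoc[symmetric])
      also have "\<dots> \<le> 1 * (fourier V h T)\<^sup>2"
        by (intro mult_right_mono power_le_one) auto
      finally show "2 ^ card T * (c T)\<^sup>2 \<le> (fourier V h T)\<^sup>2" by simp
    qed (use s in auto)
    also have "(\<Sum>T\<in>Pow V. (fourier V h T)\<^sup>2) = expect V h"
      unfolding parseval[OF fin, symmetric]
    proof (rule expect_cong)
      fix A assume "A \<subseteq> V"
      from h01[OF this] show "(h A)\<^sup>2 = h A" by auto
    qed
    finally show ?thesis using s by (intro add_left_mono mult_left_mono) auto
  qed
  also have "\<dots> = 2 * s * expect V h"
    using s by (simp add: field_simps power4_eq_xxxx power3_eq_cube)
  finally show ?thesis .
qed

section \<open>Monotone functions: derivatives, restrictions and low-degree weight\<close>

lemma sum_fourier_deriv: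
  assumes "finite V"
  shows "q * (\<Sum>i\<in>V. \<Sum>T\<in>Pow (V - {i}). F (card T) * (fourier (V - {i}) (deriv_at i f) T)\<^sup>2)
    = (\<Sum>U\<in>Pow V. real (card U) * F (card U - 1) * (fourier V f U)\<^sup>2)"
proof -
  \<comment> \<open>Double counting: \<open>U\<close> arises as \<open>insert i T\<close> once for
    each of its elements \<open>i\<close>. For \<open>U = {}\<close> the truncated
    \<open>card U - 1\<close> is harmless, as the factor \<open>card U\<close> is 0.\<close>
  let ?H = "\<lambda>i U. if i \<in> U then F (card U - 1) * (fourier V f U)\<^sup>2 else 0"
  have "q * (\<Sum>T\<in>Pow (V - {i}). F (card T) * (fourier (V - {i}) (deriv_at i f) T)\<^sup>2)
      = (\<Sum>U\<in>Pow V. ?H i U)" if i: "i \<in> V" for i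
  proof -
    define U where "U = V - {i}"
    have V: "V = insert i U" "i \<notin> U" "finite U" using i assms by (auto simp: U_def)
    have 0: "(\<Sum>T\<in>Pow U. ?H i T) = 0" using V by (intro sum.neutral) auto
    have "q * (F (card T) * (fourier U (deriv_at i f) T)\<^sup>2) = ?H i (insert i T)" if "T \<in> Pow U" for T
    proof -
      have "card (insert i T) = Suc (card T)"
        using that V by (auto intro: finite_subset card_insert_disjoint)
      moreover have "fourier V f (insert i T) = sqrt q * fourier U (deriv_at i f) T"
        unfolding V(1) using that V by (intro fourier_insert) auto
      ultimately show ?thesis using q_pos by (simp add: power_mult_distrib)
    qed
    then have "q * (\<Sum>T\<in>Pow U. F (card T) * (fourier U (deriv_at i f) T)\<^sup>2)
        = (\<Sum>T\<in>Pow U. ?H i (insert i T))"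
      unfolding sum_distrib_left by (intro sum.cong refl)
    also have "\<dots> = (\<Sum>T\<in>Pow (insert i U). ?H i T)"
      unfolding sum_Pow_insert[OF V(3,2)] 0 by simp
    also have "insert i U = V" using V by simp
    finally show ?thesis unfolding U_def .
  qed
  then have "q * (\<Sum>i\<in>V. \<Sum>T\<in>Pow (V - {i}). F (card T) * (fourier (V - {i}) (deriv_at i f) T)\<^sup>2)
      = (\<Sum>i\<in>V. \<Sum>U\<in>Pow V. ?H i U)"
    unfolding sum_distrib_left[of q _ V] by (intro sum.cong refl)
  also have "\<dots> = (\<Sum>U\<in>Pow V. \<Sum>i\<in>V. ?H i U)"
    by (rule sum.swap)
  also have "\<dots> = (\<Sum>U\<in>Pow V. real (card U) * F (card U - 1) * (fourier V f U)\<^sup>2)"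
  proof (rule sum.cong[OF refl])
    fix U assume U: "U \<in> Pow V"
    have "(\<Sum>i\<in>V. ?H i U) = (\<Sum>i\<in>U. F (card U - 1) * (fourier V f U)\<^sup>2)"
      using U assms by (intro sum.mono_neutral_cong_right) auto
    then show "(\<Sum>i\<in>V. ?H i U) = real (card U) * F (card U - 1) * (fourier V f U)\<^sup>2"
      by simp
  qed
  finally show ?thesis .
qed

text \<open>For fixed \<open>A\<close>, setting \<open>J\<close> to 1 instead of drawing it at
  random never loses, by monotonicity. If \<open>f\<close> differs between the all-ones and
  all-zeros settings of \<open>J\<close>, it gains at least the probability
  \<open>(1 - p) ^ card J\<close> of the latter, which is at least \<open>(1/2) ^ card J\<close> as
  \<open>p \<le> 1/2\<close>.\<close>

lemma restriction_gap:
  assumes "finite V" "J \<subseteq> V"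
    and mono: "\<And>A B. A \<subseteq> B \<Longrightarrow> B \<subseteq> V \<Longrightarrow> g A \<Longrightarrow> g B"
  shows "expect (V - J) (\<lambda>A. of_bool (g (A \<union> J) \<and> \<not> g A))
    \<le> 2 ^ card J * (expect (V - J) (\<lambda>A. of_bool (g (A \<union> J))) - expect V (\<lambda>A. of_bool (g A)))"
proof -
  let ?f = "\<lambda>A. of_bool (g A) :: real"
  have fin: "finite J" "finite (V - J)" using assms by (auto intro: finite_subset)
  have "(1/2) ^ card J * expect (V - J) (\<lambda>A. of_bool (g (A \<union> J) \<and> \<not> g A))
      = expect (V - J) (\<lambda>A. (1/2) ^ card J * of_bool (g (A \<union> J) \<and> \<not> g A))"
    by (simp only: expect_cmult)
  also have "\<dots> \<le> expect (V - J) (\<lambda>A. expect J (\<lambda>B. ?f (A \<union> J) - ?f (A \<union> B)))"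
  proof (rule expect_mono)
    fix A assume A: "A \<subseteq> V - J"
    have nn: "0 \<le> ?f (A \<union> J) - ?f (A \<union> B)" if "B \<subseteq> J" for B
      using mono[of "A \<union> B" "A \<union> J"] that A assms(2) by auto
    have "(1/2) ^ card J * of_bool (g (A \<union> J) \<and> \<not> g A) \<le> (1 - p) ^ card J * (?f (A \<union> J) - ?f (A \<union> {}))"
      using nn[of "{}"] p_half by (intro mult_mono power_mono) auto
    also have "\<dots> \<le> expect J (\<lambda>B. ?f (A \<union> J) - ?f (A \<union> B))"
      using fin nn by (intro expect_ge_single)
    finally show "(1/2) ^ card J * of_bool (g (A \<union> J) \<and> \<not> g A) \<le> \<dots>" .
  qed
  also have "\<dots> = expect (V - J) (\<lambda>A. ?f (A \<union> J)) - expect (V - J) (\<lambda>A. expect J (\<lambda>B. ?f (A \<union> B)))"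
    using fin by (simp only: expect_diff expect_const)
  also have "expect (V - J) (\<lambda>A. expect J (\<lambda>B. ?f (A \<union> B))) = expect V ?f"
  proof -
    have "(V - J) \<inter> J = {}" "V - J \<union> J = V" using assms(2) by auto
    then show ?thesis using expect_Un[OF fin, of ?f] by simp
  qed
  finally show ?thesis by (simp add: power_one_over field_simps)
qed

lemma deriv_at_of_bool:
  assumes "i \<in> V" "A \<subseteq> V - {i}"
    and mono: "\<And>A B. A \<subseteq> B \<Longrightarrow> B \<subseteq> V \<Longrightarrow> g A \<Longrightarrow> g B"
  shows "deriv_at i (\<lambda>A. of_bool (g A)) A = of_bool (g (insert i A) \<noteq> g A)"
  using mono[of A "insert i A"] assms(1,2) by (auto simp: deriv_at_def)

text \<open>\<open>noise_stability_bound\<close> is applied to every derivative and the results are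
  summed. Its hypothesis on generalised influences comes from \<open>global\<close> for small sets
  and from the choice of \<open>r\<close> for large ones.\<close>

lemma low_degree_weight_bound:
  assumes fin: "finite V" and s: "0 < s"
    and mono: "\<And>A B. A \<subseteq> B \<Longrightarrow> B \<subseteq> V \<Longrightarrow> g A \<Longrightarrow> g B"
    and global: "\<And>J. J \<subseteq> V \<Longrightarrow> card J \<le> r \<Longrightarrow>
        expect (V - J) (\<lambda>A. of_bool (g (A \<union> J))) - expect V (\<lambda>A. of_bool (g A)) \<le> \<delta>"
    and \<delta>: "2 * \<delta> \<le> s ^ 4" and r: "(1/4) ^ r \<le> s ^ 4"
  shows "(\<Sum>U\<in>Pow V. real (card U) * (1/8) ^ (card U - 1) * (fourier V (\<lambda>A. of_bool (g A)) U)\<^sup>2)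
    \<le> 2 * s * (q * (\<Sum>i\<in>V. expect (V - {i}) (deriv_at i (\<lambda>A. of_bool (g A)))))"
proof -
  let ?f = "\<lambda>A. of_bool (g A) :: real"
  have "(\<Sum>T\<in>Pow (V - {i}). (1/8) ^ card T * (fourier (V - {i}) (deriv_at i ?f) T)\<^sup>2)
      \<le> 2 * s * expect (V - {i}) (deriv_at i ?f)" if i: "i \<in> V" for i
  proof (rule noise_stability_bound)
    show "finite (V - {i})" using fin by simp
    show "deriv_at i ?f A = 0 \<or> deriv_at i ?f A = 1" if "A \<subseteq> V - {i}" for A
      using deriv_at_of_bool[OF i that, of g] mono by (auto simp: of_bool_def)
    fix S assume S: "S \<subseteq> V - {i}"
    let ?J = "insert i S"
    define E where "E = expect (V - ?J) (\<lambda>A. of_bool (g (A \<union> ?J) \<and> \<not> g A))"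
    have J: "?J \<subseteq> V" "card ?J = Suc (card S)"
      using S i fin by (auto intro!: card_insert_disjoint intro: finite_subset)
    have D: "V - {i} - S = V - ?J" by auto
    have "weight_above (V - {i}) (fourier (V - {i}) (deriv_at i ?f)) S
        \<le> (4 * q) ^ card S * 1\<^sup>2 * expect (V - {i} - S) (\<lambda>A. of_bool (g (A \<union> ?J) \<and> \<not> g A))"
    proof (rule weight_above_bound)
      show "\<bar>deriv_at i ?f A\<bar> \<le> 1" for A by (simp add: deriv_at_def)
      fix A T assume A: "A \<subseteq> V - {i} - S" "T \<subseteq> S" "\<not> (g (A \<union> ?J) \<and> \<not> g A)"
      \<comment> \<open>Monotonicity sandwiches both values in the derivative between
        \<open>g A\<close> and \<open>g (A \<union> ?J)\<close>; if these two agree, the derivative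
        is 0.\<close>
      have "g (insert i (A \<union> T)) \<Longrightarrow> g (A \<union> ?J)"
        using A J by (intro mono[of "insert i (A \<union> T)" "A \<union> ?J"]) auto
      moreover have "g A \<Longrightarrow> g (A \<union> T)" "g (A \<union> T) \<Longrightarrow> g (insert i (A \<union> T))"
        using A J mono[of A "A \<union> T"] mono[of "A \<union> T" "insert i (A \<union> T)"] by blast+
      ultimately show "deriv_at i ?f (A \<union> T) = 0"
        using A(3) by (auto simp: deriv_at_def)
    qed (use fin S in auto)
    then have w: "weight_above (V - {i}) (fourier (V - {i}) (deriv_at i ?f)) S \<le> (4 * q) ^ card S * E"
      unfolding D E_def by simp
    \<comment> \<open>The allowance \<open>4 ^ card S\<close> turns \<open>(4 * q) ^ card S\<close>
      into the permitted \<open>(16 * q) ^ card S\<close>. As \<open>?J\<close> has one element more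
      than \<open>S\<close>, \<open>restriction_gap\<close> leaves a spare factor 2, which
      \<open>2 * \<delta> \<le> s ^ 4\<close> pays for.\<close>
    have "E \<le> s ^ 4 * 4 ^ card S"
    proof (cases "card ?J \<le> r")
      case True
      have "E \<le> 2 ^ card ?J * (expect (V - ?J) (\<lambda>A. of_bool (g (A \<union> ?J))) - expect V ?f)"
        unfolding E_def by (rule restriction_gap) (fact fin J mono)+
      also have "\<dots> \<le> 2 ^ card ?J * \<delta>"
        using global[OF J(1) True] by (intro mult_left_mono) auto
      also have "\<dots> = 2 ^ card S * (2 * \<delta>)" by (simp add: J)
      also have "\<dots> \<le> 2 ^ card S * s ^ 4"
        using \<delta> by (intro mult_left_mono) auto
      also have "\<dots> \<le> 4 ^ card S * s ^ 4"
        using s by (intro mult_right_mono power_mono) auto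
      finally show ?thesis by (simp add: mult.commute)
    next
      case False
      have "E \<le> expect (V - ?J) (\<lambda>A. 1)" unfolding E_def by (intro expect_mono) simp
      also have "\<dots> = 1" using fin by (simp add: expect_const)
      also have "\<dots> = (1/4) ^ card S * 4 ^ card S" by (simp add: power_one_over)
      \<comment> \<open>Here \<open>card S + 1 > r\<close>, that is, \<open>card S \<ge> r\<close>,
        so the trivial bound 1 is enough.\<close>
      also have "\<dots> \<le> (1/4) ^ r * 4 ^ card S"
        using False J by (intro mult_right_mono power_decreasing) auto
      also have "\<dots> \<le> s ^ 4 * 4 ^ card S"
        using r by (intro mult_right_mono) auto
      finally show ?thesis .
    qed
    then have "(4 * q) ^ card S * E \<le> (4 * q) ^ card S * (s ^ 4 * 4 ^ card S)"
      using q_pos by (intro mult_left_mono) auto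
    also have "\<dots> = s ^ 4 * (4 * q * 4) ^ card S"
      unfolding power_mult_distrib[of "4 * q" 4] by (rule mult.left_commute)
    also have "4 * q * 4 = 16 * q" by simp
    finally show "weight_above (V - {i}) (fourier (V - {i}) (deriv_at i ?f)) S \<le> s ^ 4 * (16 * q) ^ card S"
      using w by linarith
  qed (rule s)
  then have "q * (\<Sum>i\<in>V. \<Sum>T\<in>Pow (V - {i}). (1/8) ^ card T * (fourier (V - {i}) (deriv_at i ?f) T)\<^sup>2)
      \<le> q * (\<Sum>i\<in>V. 2 * s * expect (V - {i}) (deriv_at i ?f))"
    using q_pos by (intro mult_left_mono sum_mono) auto
  then show ?thesis
    unfolding sum_fourier_deriv[OF fin, where F = "\<lambda>t. (1/8) ^ t"]
    by (simp add: sum_distrib_left[symmetric] mult_ac)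
qed

text \<open>The case \<open>F = 1\<close> of \<open>sum_fourier_deriv\<close>: by monotonicity each
  derivative equals its own square, so Parseval gives its expectation.\<close>

lemma sum_card_fourier:
  assumes fin: "finite V"
    and mono: "\<And>A B. A \<subseteq> B \<Longrightarrow> B \<subseteq> V \<Longrightarrow> g A \<Longrightarrow> g B"
  shows "(\<Sum>U\<in>Pow V. real (card U) * (fourier V (\<lambda>A. of_bool (g A)) U)\<^sup>2)
    = q * (\<Sum>i\<in>V. expect (V - {i}) (deriv_at i (\<lambda>A. of_bool (g A))))"
proof -
  let ?f = "\<lambda>A. of_bool (g A) :: real"
  have "(\<Sum>T\<in>Pow (V - {i}). (fourier (V - {i}) (deriv_at i ?f) T)\<^sup>2) = expect (V - {i}) (deriv_at i ?f)"
    if i: "i \<in> V" for i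
  proof -
    have "(\<Sum>T\<in>Pow (V - {i}). (fourier (V - {i}) (deriv_at i ?f) T)\<^sup>2)
        = expect (V - {i}) (\<lambda>A. (deriv_at i ?f A)\<^sup>2)"
      using fin by (simp add: parseval)
    also have "\<dots> = expect (V - {i}) (deriv_at i ?f)"
    proof (rule expect_cong)
      fix A assume "A \<subseteq> V - {i}"
      then show "(deriv_at i ?f A)\<^sup>2 = deriv_at i ?f A"
        using deriv_at_of_bool[OF i, of A g] mono by (auto simp: of_bool_def)
    qed
    finally show ?thesis .
  qed
  then show ?thesis
    using sum_fourier_deriv[OF fin, of "\<lambda>_. 1" ?f] by simp
qed

section \<open>Variance against total influence\<close>

lemma variance_eq:
  assumes "finite V"
  shows "expect V (\<lambda>A. of_bool (g A)) * (1 - expect V (\<lambda>A. of_bool (g A)))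
    = (\<Sum>U\<in>Pow V - {{}}. (fourier V (\<lambda>A. of_bool (g A)) U)\<^sup>2)"
proof -
  let ?f = "\<lambda>A. of_bool (g A) :: real"
  have "(\<Sum>U\<in>Pow V. (fourier V ?f U)\<^sup>2) = expect V ?f"
    unfolding parseval[OF assms, symmetric] by (intro expect_cong) auto
  moreover have "fourier V ?f {} = expect V ?f"
    by (simp add: fourier_def chi_def)
  moreover have "(\<Sum>U\<in>Pow V. (fourier V ?f U)\<^sup>2)
      = (fourier V ?f {})\<^sup>2 + (\<Sum>U\<in>Pow V - {{}}. (fourier V ?f U)\<^sup>2)"
    using assms by (intro sum.remove) auto
  ultimately show ?thesis by (simp add: power2_eq_square algebra_simps)
qed

text \<open>Gives a lower bound on \<open>K\<close> in \<open>exists_boosting_set\<close>, so that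
  additive constants there can be absorbed into multiples of \<open>K\<close>.\<close>

lemma poincare:
  assumes fin: "finite V"
    and mono: "\<And>A B. A \<subseteq> B \<Longrightarrow> B \<subseteq> V \<Longrightarrow> g A \<Longrightarrow> g B"
  shows "expect V (\<lambda>A. of_bool (g A)) * (1 - expect V (\<lambda>A. of_bool (g A)))
    \<le> q * (\<Sum>i\<in>V. expect (V - {i}) (deriv_at i (\<lambda>A. of_bool (g A))))"
proof -
  let ?f = "\<lambda>A. of_bool (g A) :: real"
  have "(\<Sum>U\<in>Pow V - {{}}. (fourier V ?f U)\<^sup>2)
      \<le> (\<Sum>U\<in>Pow V - {{}}. real (card U) * (fourier V ?f U)\<^sup>2)"
  proof (rule sum_mono)
    fix U assume "U \<in> Pow V - {{}}"
    then have "1 \<le> card U" using fin by (auto simp: Suc_le_eq card_gt_0_iff intro: finite_subset)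
    then show "(fourier V ?f U)\<^sup>2 \<le> real (card U) * (fourier V ?f U)\<^sup>2"
      using mult_right_mono[of 1 "real (card U)" "(fourier V ?f U)\<^sup>2"] by simp
  qed
  also have "\<dots> \<le> (\<Sum>U\<in>Pow V. real (card U) * (fourier V ?f U)\<^sup>2)"
    using fin by (intro sum_mono2) auto
  also have "\<dots> = q * (\<Sum>i\<in>V. expect (V - {i}) (deriv_at i ?f))"
    by (rule sum_card_fourier) (fact fin mono)+
  finally show ?thesis unfolding variance_eq[OF fin] .
qed

text \<open>Levels from \<open>m\<close> on carry weight at most \<open>K / m\<close> by Markov's
  inequality; on lower levels the damping is undone at the cost of \<open>8 powr m\<close>.\<close>

lemma variance_bound:
  assumes fin: "finite V" and s: "0 < s" and m: "0 < m"
    and mono: "\<And>A B. A \<subseteq> B \<Longrightarrow> B \<subseteq> V \<Longrightarrow> g A \<Longrightarrow> g B"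
    and global: "\<And>J. J \<subseteq> V \<Longrightarrow> card J \<le> r \<Longrightarrow>
        expect (V - J) (\<lambda>A. of_bool (g (A \<union> J))) - expect V (\<lambda>A. of_bool (g A)) \<le> \<delta>"
    and \<delta>: "2 * \<delta> \<le> s ^ 4" and r: "(1/4) ^ r \<le> s ^ 4"
    and K: "q * (\<Sum>i\<in>V. expect (V - {i}) (deriv_at i (\<lambda>A. of_bool (g A)))) \<le> K"
  shows "expect V (\<lambda>A. of_bool (g A)) * (1 - expect V (\<lambda>A. of_bool (g A)))
    \<le> 8 powr m * (2 * s * K) + K / m"
proof -
  let ?f = "\<lambda>A. of_bool (g A) :: real"
  let ?x = "\<lambda>U. (fourier V ?f U)\<^sup>2"
  let ?L = "\<lambda>U. real (card U) * (1/8) ^ (card U - 1) * ?x U"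
  \<comment> \<open>One inequality per level avoids splitting the sum: the second term is at least 1
    for \<open>t \<ge> m\<close>, the first for \<open>t < m\<close>.\<close>
  have level: "1 \<le> real t * (1/8) ^ (t - 1) * 8 powr m + real t / m" if t: "1 \<le> t" for t
  proof (cases "m \<le> real t")
    case True
    then have "1 \<le> real t / m" using m by simp
    then show ?thesis by (simp add: add_increasing)
  next
    case False
    have "(1/8 :: real) ^ (t - 1) * 8 powr m = 8 powr (m - real (t - 1))"
      by (simp add: powr_diff powr_realpow power_one_over field_simps)
    also have "\<dots> \<ge> 1" using False t by (intro ge_one_powr_ge_zero) auto
    finally have "1 * 1 \<le> real t * ((1/8) ^ (t - 1) * 8 powr m)"
      using t by (intro mult_mono) auto
    then show ?thesis using m by (simp add: add_increasing2 mult.assoc)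
  qed
  have "(\<Sum>U\<in>Pow V - {{}}. ?x U)
      \<le> (\<Sum>U\<in>Pow V - {{}}. 8 powr m * ?L U + real (card U) * ?x U / m)"
  proof (rule sum_mono)
    fix U assume "U \<in> Pow V - {{}}"
    then have "1 \<le> card U" using fin by (auto simp: Suc_le_eq card_gt_0_iff intro: finite_subset)
    from mult_right_mono[OF level[OF this], of "?x U"]
    show "?x U \<le> 8 powr m * ?L U + real (card U) * ?x U / m"
      by (simp add: algebra_simps)
  qed
  also have "\<dots> \<le> (\<Sum>U\<in>Pow V. 8 powr m * ?L U + real (card U) * ?x U / m)"
    using fin m by (intro sum_mono2) auto
  also have "\<dots> = 8 powr m * (\<Sum>U\<in>Pow V. ?L U) + (\<Sum>U\<in>Pow V. real (card U) * ?x U) / m"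
    by (simp add: sum.distrib sum_distrib_left sum_divide_distrib)
  also have "\<dots> \<le> 8 powr m * (2 * s * K) + K / m"
  proof (intro add_mono mult_left_mono divide_right_mono)
    have "(\<Sum>U\<in>Pow V. ?L U) \<le> 2 * s * (q * (\<Sum>i\<in>V. expect (V - {i}) (deriv_at i ?f)))"
      by (rule low_degree_weight_bound) (fact fin s mono global \<delta> r)+
    also have "\<dots> \<le> 2 * s * K" using K s by (intro mult_left_mono) auto
    finally show "(\<Sum>U\<in>Pow V. ?L U) \<le> 2 * s * K" .
    show "(\<Sum>U\<in>Pow V. real (card U) * ?x U) \<le> K"
      by (subst sum_card_fourier) (fact fin mono K)+
  qed (use m in auto)
  finally show ?thesis unfolding variance_eq[OF fin] .
qed

section \<open>Translation between the measures on the cube and sums over subsets\<close>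

lemma mu_eq_expect:
  assumes fin: "finite S"
  shows "mu S p f = expect S (\<lambda>A. of_bool (f (\<lambda>i. i \<in> A)))"
proof -
  let ?ind = "\<lambda>A i. i \<in> (A :: nat set)"
  have bij: "bij_betw ?ind (Pow S) (cube S)"
  proof (rule bij_betw_byWitness[where f' = Collect])
    show "\<forall>x\<in>cube S. ?ind (Collect x) = x" by simp
    show "?ind ` Pow S \<subseteq> cube S" by (auto simp: cube_def PiE_dflt_def)
    show "Collect ` cube S \<subseteq> Pow S"
      by (auto simp: cube_def PiE_dflt_def)
  qed auto
  have pmf: "pmf (biased_pmf S p) (?ind A) = p ^ card A * (1 - p) ^ card (S - A)" if A: "A \<in> Pow S" for A
  proof -
    have "pmf (biased_pmf S p) (?ind A) = (\<Prod>i\<in>S. pmf (bernoulli_pmf p) (i \<in> A))"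
      unfolding biased_pmf_def using fin A by (intro pmf_Pi') auto
    also have "\<dots> = (\<Prod>i\<in>S. if i \<in> A then p else 1 - p)"
      using p_pos p_half by (intro prod.cong) auto
    also have "\<dots> = p ^ card (S \<inter> A) * (1 - p) ^ card (S - A)"
      using fin by (simp add: prod.If_cases Diff_eq)
    also have "S \<inter> A = A" using A by auto
    finally show ?thesis .
  qed
  have "mu S p f = measure_pmf.expectation (biased_pmf S p) (indicator {x. f x})"
    by (simp add: mu_def)
  also have "\<dots> = (\<Sum>x\<in>cube S. indicator {x. f x} x * pmf (biased_pmf S p) x)"
  proof (rule integral_measure_pmf_real)
    show "finite (cube S)" using bij fin by (simp add: bij_betw_finite[symmetric])
    show "x \<in> cube S" if "x \<in> set_pmf (biased_pmf S p)" for x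
      using that set_Pi_pmf_subset[OF fin, of False "\<lambda>_. bernoulli_pmf p"]
      by (auto simp: biased_pmf_def cube_def PiE_dflt_def)
  qed
  also have "\<dots> = (\<Sum>A\<in>Pow S. indicator {x. f x} (?ind A) * pmf (biased_pmf S p) (?ind A))"
    by (rule sum.reindex_bij_betw[OF bij, symmetric])
  also have "\<dots> = expect S (\<lambda>A. of_bool (f (?ind A)))"
    unfolding expect_def by (intro sum.cong refl) (simp add: pmf indicator_def)
  finally show ?thesis .
qed

text \<open>Whether flipping \<open>i\<close> changes \<open>f\<close> does not depend on the
  coordinate \<open>i\<close> itself, so both halves of \<open>expect_insert\<close> agree and the
  weights \<open>1 - p\<close> and \<open>p\<close> add up to 1. Monotonicity removes the absolute
  value of the derivative.\<close>

lemma influence_eq_expect: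
  assumes fin: "finite V" and i: "i \<in> V"
    and mono: "\<And>A B. A \<subseteq> B \<Longrightarrow> B \<subseteq> V \<Longrightarrow> f (\<lambda>j. j \<in> A) \<Longrightarrow> f (\<lambda>j. j \<in> B)"
  shows "influence V p f i = expect (V - {i}) (deriv_at i (\<lambda>A. of_bool (f (\<lambda>j. j \<in> A))))"
proof -
  define U where "U = V - {i}"
  have V: "V = insert i U" "i \<notin> U" "finite U" using fin i by (auto simp: U_def)
  let ?g = "\<lambda>A. f (\<lambda>j. j \<in> A)"
  let ?F = "\<lambda>A. of_bool (f ((\<lambda>j. j \<in> A)(i := i \<notin> A)) \<noteq> ?g A) :: real"
  have upd: "(\<lambda>j. j \<in> A)(i := True) = (\<lambda>j. j \<in> insert i A)"
    "(\<lambda>j. j \<in> insert i A)(i := False) = (\<lambda>j. j \<in> A)" if "i \<notin> A" for A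
    using that by (auto simp: fun_eq_iff)
  have F: "?F A = deriv_at i (\<lambda>A. of_bool (?g A)) A"
    "?F (insert i A) = deriv_at i (\<lambda>A. of_bool (?g A)) A" if A: "A \<subseteq> U" for A
  proof -
    have "i \<notin> A" using A V by auto
    moreover have "deriv_at i (\<lambda>A. of_bool (?g A)) A = of_bool (?g (insert i A) \<noteq> ?g A)"
      by (rule deriv_at_of_bool) (use A i mono in \<open>auto simp: U_def\<close>)
    ultimately show "?F A = deriv_at i (\<lambda>A. of_bool (?g A)) A"
      "?F (insert i A) = deriv_at i (\<lambda>A. of_bool (?g A)) A"
      using upd[of A] by auto
  qed
  have "influence V p f i = expect V ?F"
    using mu_eq_expect[OF fin, of "\<lambda>x. f (x(i := \<not> x i)) \<noteq> f x"]
    by (simp add: influence_def mu_def)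
  also have "\<dots> = (1 - p) * expect U ?F + p * expect U (\<lambda>A. ?F (insert i A))"
    unfolding V(1) by (rule expect_insert[OF V(3,2)])
  also have "expect U ?F = expect U (deriv_at i (\<lambda>A. of_bool (?g A)))"
    by (rule expect_cong) (rule F)
  also have "expect U (\<lambda>A. ?F (insert i A)) = expect U (deriv_at i (\<lambda>A. of_bool (?g A)))"
    by (rule expect_cong) (rule F)
  finally show ?thesis by (simp add: U_def algebra_simps)
qed

lemma mu_restrict_to_one:
  assumes "finite V"
  shows "mu (V - J) p (restrict_to_one J f) = expect (V - J) (\<lambda>A. of_bool (f (\<lambda>i. i \<in> A \<union> J)))"
proof -
  have "override_on (\<lambda>i. i \<in> A) (\<lambda>_. True) J = (\<lambda>i. i \<in> A \<union> J)" for A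
    by (auto simp: override_on_def fun_eq_iff)
  then show ?thesis
    using assms by (simp add: mu_eq_expect restrict_to_one_def)
qed

section \<open>Choice of constants and the boosting set\<close>

lemma exists_boosting_set:
  assumes fin: "finite V" and mono_f: "mono_on (cube V) f"
    and v: "0 < v" "v \<le> 1" "v \<le> mu V p f * (1 - mu V p f)"
    and infl: "total_influence V p f \<le> K / p"
    and C: "C = 4 * (ln (4 / v) / v + 1 + 6 / v) + 1 / v"
  shows "\<exists>J\<subseteq>V. real (card J) \<le> C * K \<and> mu V p f + exp (- (C * K)) \<le> mu (V - J) p (restrict_to_one J f)"
proof (rule ccontr)
  assume neg: "\<not> ?thesis"
  define g where "g A = f (\<lambda>i. i \<in> A)" for A
  have mono: "g B" if "A \<subseteq> B" "B \<subseteq> V" "g A" for A B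
  proof -
    have "(\<lambda>i. i \<in> A) \<in> cube V" "(\<lambda>i. i \<in> B) \<in> cube V" "(\<lambda>i. i \<in> A) \<le> (\<lambda>i. i \<in> B)"
      using that by (auto simp: cube_def PiE_dflt_def)
    from mono_onD[OF mono_f this] show ?thesis using that by (simp add: g_def)
  qed
  define I where "I = (\<Sum>i\<in>V. expect (V - {i}) (deriv_at i (\<lambda>A. of_bool (g A))))"
  have mu_g: "mu V p f = expect V (\<lambda>A. of_bool (g A))"
    using fin by (simp add: mu_eq_expect g_def)
  have I_eq: "total_influence V p f = I"
    unfolding total_influence_def I_def g_def
    by (intro sum.cong refl influence_eq_expect fin) (use mono in \<open>auto simp: g_def\<close>)
  have vqI: "v \<le> q * I"
  proof -
    have "expect V (\<lambda>A. of_bool (g A)) * (1 - expect V (\<lambda>A. of_bool (g A))) \<le> q * I"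
      unfolding I_def by (rule poincare) (fact fin mono)+
    then show ?thesis using v mu_g by simp
  qed
  \<comment> \<open>Since \<open>q \<le> p\<close>, the assumption \<open>I \<le> K / p\<close>
    bounds \<open>q * I\<close>; multiplying by \<open>I\<close> needs its sign, supplied by
    \<open>vqI\<close>.\<close>
  have qIK: "q * I \<le> K"
  proof -
    have "0 < q * I" using vqI v by simp
    then have "0 < I" using q_pos by (simp add: zero_less_mult_iff)
    then have "q * I \<le> p * I" using p_pos by (intro mult_right_mono) (auto simp: q_def)
    also have "\<dots> \<le> K" using infl p_pos by (simp add: I_eq field_simps)
    finally show ?thesis .
  qed
  have K: "v \<le> K" "0 < K" using vqI qIK v by auto
  then have Kv: "1 \<le> K / v" using v by simp
  \<comment> \<open>With \<open>s = exp (- (D * K / 4))\<close>, the three summands of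
    \<open>D\<close> pay for a final factor \<open>v / 4\<close>, for \<open>K < exp K\<close>, and
    for \<open>8 powr (2 * K / v) \<le> exp (6 * K / v)\<close>. The surplus
    \<open>K / v \<ge> 1\<close> of \<open>C * K\<close> over \<open>D * K\<close> absorbs the
    rounding in \<open>r\<close> and the factor 2 in
    \<open>2 * \<delta> \<le> s ^ 4\<close>.\<close>
  define D where "D = 4 * (ln (4 / v) / v + 1 + 6 / v)"
  have ln4: "0 \<le> ln (4 / v)" using v by simp
  then have D: "0 < D" using v by (auto simp: D_def intro!: add_nonneg_pos add_pos_nonneg)
  have CK: "C * K = D * K + K / v" by (simp add: C D_def algebra_simps)
  define r where "r = nat \<lceil>D * K\<rceil>"
  define s where "s = exp (- (D * K / 4))"
  have r: "D * K \<le> real r" "real r \<le> C * K"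
  proof -
    have pos: "0 < D * K" using D K by simp
    then show "D * K \<le> real r" unfolding r_def by linarith
    have "real r \<le> D * K + 1" using pos unfolding r_def by linarith
    then show "real r \<le> C * K" using Kv CK by linarith
  qed
  have s4: "s ^ 4 = exp (- (D * K))"
    by (simp add: s_def exp_of_nat_mult[symmetric])
  have two: "2 \<le> exp (1::real)" using exp_ge_add_one_self[of 1] by simp
  have "v \<le> mu V p f * (1 - mu V p f)" by (rule v)
  \<comment> \<open>The threshold \<open>m = 2 * K / v\<close> leaves exactly \<open>v / 2\<close>
    for the high levels.\<close>
  also have "\<dots> \<le> 8 powr (2 * K / v) * (2 * s * K) + K / (2 * K / v)"
    unfolding mu_g
  proof (rule variance_bound)
    show "finite V" "0 < s" "0 < 2 * K / v" using fin K v by (auto simp: s_def)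
    show "g B" if "A \<subseteq> B" "B \<subseteq> V" "g A" for A B by (rule mono) (fact that)+
    show "expect (V - J) (\<lambda>A. of_bool (g (A \<union> J))) - expect V (\<lambda>A. of_bool (g A)) \<le> exp (- (C * K))"
      if "J \<subseteq> V" "card J \<le> r" for J
    proof -
      have "real (card J) \<le> C * K" using that r by linarith
      then have "\<not> mu V p f + exp (- (C * K)) \<le> mu (V - J) p (restrict_to_one J f)"
        using neg that by blast
      then show ?thesis
        using fin by (simp add: mu_g mu_restrict_to_one g_def)
    qed
    have "2 \<le> exp (K / v)" using two Kv order_trans[of 2 "exp 1" "exp (K / v)"] by simp
    then have "2 * exp (- (C * K)) \<le> exp (K / v) * exp (- (C * K))"
      by (intro mult_right_mono) auto
    also have "\<dots> = s ^ 4" by (simp add: s4 CK exp_add[symmetric])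
    finally show "2 * exp (- (C * K)) \<le> s ^ 4" .
    have "(1/4 :: real) \<le> exp (- 1)"
      using exp_le by (simp add: exp_minus field_simps)
    then have "(1/4 :: real) ^ r \<le> exp (- 1) ^ r" by (intro power_mono) auto
    also have "\<dots> = exp (- real r)" by (simp add: exp_of_nat_mult[symmetric])
    also have "\<dots> \<le> s ^ 4" using r by (simp add: s4)
    finally show "(1/4) ^ r \<le> s ^ 4" .
    show "q * (\<Sum>i\<in>V. expect (V - {i}) (deriv_at i (\<lambda>A. of_bool (g A)))) \<le> K"
      using qIK by (simp add: I_def)
  qed
  also have "K / (2 * K / v) = v / 2" using K v by simp
  also have "8 powr (2 * K / v) * (2 * s * K) < v / 2"
  proof -
    have "(2::real) ^ 3 \<le> exp 1 ^ 3" using two by (intro power_mono) auto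
    then have "ln (8::real) \<le> ln (exp 3)" by (intro ln_mono) (simp_all add: exp_of_nat_mult[symmetric])
    then have "8 powr (2 * K / v) \<le> exp (6 * K / v)"
      using K v mult_left_mono[of "ln 8" "3::real" "2 * K / v"] by (simp add: powr_def)
    moreover have "K < exp K" using exp_ge_add_one_self[of K] by linarith
    ultimately have "8 powr (2 * K / v) * (2 * s * K) < exp (6 * K / v) * (2 * s * exp K)"
      using K by (intro mult_le_less_imp_less mult_strict_left_mono) (auto simp: s_def)
    also have "\<dots> = 2 * exp (- (ln (4 / v) * (K / v)))"
    proof -
      have "6 * K / v + - (D * K / 4) + K = - (ln (4 / v) * (K / v))"
        by (simp add: D_def algebra_simps)
      then show ?thesis
        unfolding s_def by (simp add: exp_add[symmetric] mult_ac)
    qed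
    also have "\<dots> \<le> 2 * exp (- (ln (4 / v) * 1))"
      using ln4 Kv mult_left_mono[OF Kv ln4] by simp
    also have "\<dots> = v / 2" using v by (simp add: exp_minus)
    finally show ?thesis .
  qed
  finally show False by simp
qed

end

theorem theorem1p4:
  fixes \<epsilon> :: real
  assumes "\<epsilon> > 0"
  shows "\<exists>C\<^sub>1>0. \<exists>C\<^sub>2>0. \<forall>(n::nat) (p::real) (K::real) (f :: (nat \<Rightarrow> bool) \<Rightarrow> bool).
    0 < p \<longrightarrow> p \<le> 1/2 \<longrightarrow>
    mono_on (cube {1..n}) f \<longrightarrow>
    \<epsilon> \<le> mu {1..n} p f \<longrightarrow> mu {1..n} p f \<le> 1 - \<epsilon> \<longrightarrow>
    total_influence {1..n} p f \<le> K / p \<longrightarrow>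
    (\<exists>J\<subseteq>{1..n}. real (card J) \<le> C\<^sub>1 * K \<and>
       mu ({1..n} - J) p (restrict_to_one J f) \<ge> mu {1..n} p f + exp (- (C\<^sub>2 * K)))"
proof (cases "\<epsilon> < 1")
  case True
  define v where "v = \<epsilon> * (1 - \<epsilon>)"
  define C where "C = 4 * (ln (4 / v) / v + 1 + 6 / v) + 1 / v"
  have v: "0 < v" "v \<le> 1"
    using True assms mult_mono[of \<epsilon> 1 "1 - \<epsilon>" 1] by (auto simp: v_def)
  then have "0 \<le> ln (4 / v)" by simp
  then have C_pos: "C > 0"
    using v by (auto simp: C_def intro!: add_nonneg_pos add_nonneg_nonneg)
  have "\<exists>J\<subseteq>{1..n}. real (card J) \<le> C * K \<and>
       mu ({1..n} - J) p (restrict_to_one J f) \<ge> mu {1..n} p f + exp (- (C * K))"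
    if "0 < p" "p \<le> 1/2" "mono_on (cube {1..n}) f" "\<epsilon> \<le> mu {1..n} p f" "mu {1..n} p f \<le> 1 - \<epsilon>"
      "total_influence {1..n} p f \<le> K / p"
    for n :: nat and p K :: real and f
  proof -
    interpret biased_cube p by standard (fact that)+
    \<comment> \<open>Expanding this product shows that \<open>x * (1 - x)\<close> is at least
      \<open>\<epsilon> * (1 - \<epsilon>)\<close> for \<open>x\<close> between
      \<open>\<epsilon>\<close> and \<open>1 - \<epsilon>\<close>.\<close>
    have "0 \<le> (mu {1..n} p f - \<epsilon>) * (1 - \<epsilon> - mu {1..n} p f)"
      using that by (intro mult_nonneg_nonneg) auto
    then have "v \<le> mu {1..n} p f * (1 - mu {1..n} p f)"
      by (simp add: v_def algebra_simps)
    then show ?thesis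
      using exists_boosting_set[of "{1..n}" f v K C] that v C_def by simp
  qed
  then show ?thesis using C_pos by (intro exI[of _ C] conjI allI impI) auto
next
  case False
  \<comment> \<open>For \<open>\<epsilon> \<ge> 1\<close> no measure meets both bounds, so any
    positive constants do.\<close>
  have "\<not> (\<epsilon> \<le> x \<and> x \<le> 1 - \<epsilon>)" for x
    using False by auto
  then show ?thesis by (intro exI[of _ "1::real"] conjI) (simp, simp, blast)
qed

end
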